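(* Let $\mathbb G$ be a finite abelian group of order $n$, let $\mathbb H$ be a subgroup of $\mathbb G$ of order $l$, and let $\mathcal F=\{f_g\}_{g\in\mathbb G}$ be the $\mathbb G$-harmonic frame for $\mathbb C^m$ generated by an $(n,m,l,\lambda,\mu)$-divisible difference set $\mathcal S=\{g_1,\dots,g_m\}$ for $\mathbb G$ relative to $\mathbb H$. Then either (1) $\lambda=\mu$ and $\mathcal F$ is an equiangular tight frame, or (2) $\lambda\neq\mu$ and $\mathcal F$ is a biangular tight frame with frame angles $$\alpha_1=\frac1m\sqrt{m-\lambda+l(\lambda-\mu)}\quad\text{and}\quad \alpha_2=\frac1m\sqrt{m-\lambda}$$ and frame angle multiplicities $$\tau_1=\frac nl\quad\text{and}\quad \tau_2=n-\frac nl-1 .$$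
   Context: $\mathbb G$ is a finite abelian group of order $n$, written additively with identity $0_G$, with a fixed decomposition $\mathbb G=\mathbb Z_{n_1}\oplus\cdots\oplus\mathbb Z_{n_k}$. For $x,y\in\mathbb G$ put $\rho_x(y)=e^{2\pi i\left(\frac{x(1)y(1)}{n_1}+\cdots+\frac{x(k)y(k)}{n_k}\right)}$. Harmonic frame: for a set $\mathcal S=\{g_1,\dots,g_m\}$ of $m$ distinct elements of $\mathbb G$, the $\mathbb G$-harmonic frame generated by $\mathcal S$ is the family $\{f_x\}_{x\in\mathbb G}\subset\mathbb C^m$ with $f_x=\frac1{\sqrt m}(\rho_{g_j}(x))_{j=1}^m$. A family $\{f_x\}$ in $\mathbb C^m$ is a tight frame if $\sum_x f_xf_x^*=aI_m$ for some $a>0$. The frame angles of a unit-norm frame are the elements of $\{|\langle f_x,f_y\rangle|: x\neq y\}$ (indices distinct); the frame is equiangular (respectively biangular) if this set has exactly one (respectively exactly two) elements. The frame has frame angle multiplicity $\tau_i$ for the frame angle $\alpha_i$ if for every index $x$ there are exactly $\tau_i$ indices $y\ne x$ with $|\langle f_x,f_y\rangle|=\alpha_i$. Divisible difference set: an $m$-element subset $\mathcal S=\{g_1,\dots,g_m\}\subset\mathbb G$ is an $(n,m,l,\lambda,\mu)$-divisible difference set for $\mathbb G$ relative to a subgroup $\mathbb H$ of order $l$, where $\lambda,\mu$ are nonnegative integers, if every element of $\mathbb H\setminus\{0_G\}$ can be written as $g_a-g_b$ in exactly $\lambda$ ways (number of ordered pairs $(a,b)$), and every element of $\mathbb G\setminus\mathbb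 H$ can be written as $g_a-g_b$ in exactly $\mu$ ways.
   Formalization: The multiplicities are corrected to τ1 = n/l − 1 and τ2 = n − n/l (the printed ones fail for {0,1} in Z_4 relative to {0,2}); it is assumed that n ≥ 2, and that 1 < l < n when λ ≠ μ, since otherwise there are no two frame angles (none at all if n = 1). *)

theory Defs
  imports "HOL-Analysis.Analysis" "HOL-Algebra.Algebra"
begin

text \<open>
  The group \<open>\<int>\<^sub>N\<^sub>0 \<oplus> \<dots> \<oplus> \<int>\<^sub>N\<^sub>k\<^sub>-\<^sub>1\<close>, with components indexed from 0. In this record \<open>\<otimes>\<close> is the
  (componentwise, modular) addition, \<open>inv\<close> the negation and \<open>\<one>\<close> the zero element; an element is an
  extensional function whose \<open>i\<close>-th value is the representative in \<open>{0..<N i}\<close>.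
  Since \<open>integer_mod_group 0\<close> is the infinite cyclic group, \<open>N i > 0\<close> has to be assumed for finiteness.
\<close>

definition cyclic_sum :: "nat \<Rightarrow> (nat \<Rightarrow> nat) \<Rightarrow> (nat \<Rightarrow> int) monoid" where
  "cyclic_sum k N = product_group {..<k} (\<lambda>i. integer_mod_group (N i))"

definition rho :: "nat \<Rightarrow> (nat \<Rightarrow> nat) \<Rightarrow> (nat \<Rightarrow> int) \<Rightarrow> (nat \<Rightarrow> int) \<Rightarrow> complex" where
  "rho k N x y =
     exp (2 * complex_of_real pi * \<i> * (\<Sum>i<k. of_int (x i) * of_int (y i) / of_nat (N i)))"

text \<open>
  The generating set is given by an enumeration \<open>g\<close> over the coordinate type of the ambient space,
  which is to be injective; thus \<open>m = CARD('m)\<close>.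
\<close>

definition harmonic_frame ::
    "nat \<Rightarrow> (nat \<Rightarrow> nat) \<Rightarrow> ('m::finite \<Rightarrow> nat \<Rightarrow> int) \<Rightarrow> (nat \<Rightarrow> int) \<Rightarrow> complex ^ 'm" where
  "harmonic_frame k N g x =
     (\<chi> j. complex_of_real (1 / sqrt (real CARD('m))) * rho k N (g j) x)"

text \<open>The library inner product on \<open>complex ^ 'm\<close> is the real one, so the Hermitian one is defined here.\<close>

definition cinner_vec :: "complex ^ 'm::finite \<Rightarrow> complex ^ 'm \<Rightarrow> complex" where
  "cinner_vec v w = (\<Sum>j\<in>UNIV. v $ j * cnj (w $ j))"

text \<open>The rank one matrix \<open>v v\<^sup>*\<close>.\<close>

definition outer_vec :: "complex ^ 'm::finite \<Rightarrow> complex ^ 'm ^ 'm" where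
  "outer_vec v = (\<chi> i j. v $ i * cnj (v $ j))"

definition tight_frame :: "'i set \<Rightarrow> ('i \<Rightarrow> complex ^ 'm::finite) \<Rightarrow> bool" where
  "tight_frame I f \<longleftrightarrow> (\<exists>a::real. a > 0 \<and> (\<Sum>x\<in>I. outer_vec (f x)) = a *\<^sub>R mat 1)"

definition unit_norm :: "'i set \<Rightarrow> ('i \<Rightarrow> complex ^ 'm::finite) \<Rightarrow> bool" where
  "unit_norm I f \<longleftrightarrow> (\<forall>x\<in>I. norm (f x) = 1)"

definition frame_angles :: "'i set \<Rightarrow> ('i \<Rightarrow> complex ^ 'm::finite) \<Rightarrow> real set" where
  "frame_angles I f = {cmod (cinner_vec (f x) (f y)) | x y. x \<in> I \<and> y \<in> I \<and> x \<noteq> y}"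

definition equiangular :: "'i set \<Rightarrow> ('i \<Rightarrow> complex ^ 'm::finite) \<Rightarrow> bool" where
  "equiangular I f \<longleftrightarrow> unit_norm I f \<and> card (frame_angles I f) = 1"

definition biangular :: "'i set \<Rightarrow> ('i \<Rightarrow> complex ^ 'm::finite) \<Rightarrow> bool" where
  "biangular I f \<longleftrightarrow> unit_norm I f \<and> card (frame_angles I f) = 2"

definition angle_multiplicity ::
    "'i set \<Rightarrow> ('i \<Rightarrow> complex ^ 'm::finite) \<Rightarrow> real \<Rightarrow> nat \<Rightarrow> bool" where
  "angle_multiplicity I f \<alpha> \<tau> \<longleftrightarrow>
     (\<forall>x\<in>I. card {y \<in> I. y \<noteq> x \<and> cmod (cinner_vec (f x) (f y)) = \<alpha>} = \<tau>)"

definition divisible_difference_set ::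
    "('a, 'b) monoid_scheme \<Rightarrow> 'a set \<Rightarrow> nat \<Rightarrow> nat \<Rightarrow> nat \<Rightarrow> nat \<Rightarrow> nat \<Rightarrow> 'a set \<Rightarrow> bool" where
  "divisible_difference_set G H n m l lam mu S \<longleftrightarrow>
     comm_group G \<and> finite (carrier G) \<and> order G = n \<and>
     subgroup H G \<and> card H = l \<and>
     S \<subseteq> carrier G \<and> card S = m \<and>
     (\<forall>h \<in> H - {\<one>\<^bsub>G\<^esub>}.
        card {(a, b). a \<in> S \<and> b \<in> S \<and> a \<otimes>\<^bsub>G\<^esub> inv\<^bsub>G\<^esub> b = h} = lam) \<and>
     (\<forall>h \<in> carrier G - H.
        card {(a, b). a \<in> S \<and> b \<in> S \<and> a \<otimes>\<^bsub>G\<^esub> inv\<^bsub>G\<^esub> b = h} = mu)"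

text \<open>
  On multiplicities: for \<open>x \<noteq> y\<close> the squared angle is
  \<open>(m - lam + (lam - mu) * (\<Sum>h\<in>H. \<chi> h)) / m\<^sup>2\<close> with \<open>\<chi>\<close> the nontrivial character attached to \<open>x - y\<close>,
  and \<open>\<Sum>h\<in>H. \<chi> h\<close> is \<open>l\<close> or \<open>0\<close> according as \<open>\<chi>\<close> is trivial on \<open>H\<close> or not. There are \<open>n / l\<close> characters
  trivial on \<open>H\<close>, one of which is the trivial character (\<open>y = x\<close>), which a frame angle excludes. So the
  angle multiplicities are \<open>n / l - 1\<close> and \<open>n - n / l\<close>. The source prints \<open>n / l\<close> and
  \<open>n - n / l - 1\<close>, which counts \<open>y = x\<close> towards the wrong angle and contradicts its own definition
  of multiplicity: \<open>{0, 1}\<close> in \<open>\<int>\<^sub>4\<close> relative to \<open>{0, 2}\<close> has multiplicities 1 and 2.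

  On degenerate parameters: for \<open>l = 1\<close> no difference constrains \<open>lam\<close>, for \<open>l = n\<close> none constrains \<open>mu\<close>;
  then \<open>lam \<noteq> mu\<close> is possible for an equiangular frame, so \<open>lam \<noteq> mu\<close> is only meaningful for \<open>1 < l < n\<close>.
  A one-element group has no pair of distinct indices, hence no frame angle at all.
\<close>

end

theory Submission
  imports Defs
begin

text \<open>
  The map \<open>rho\<close> is a nondegenerate symmetric bicharacter of the group \<open>G\<close>. Because it is
  multiplicative, the inner product of \<open>f x\<close> and \<open>f y\<close> depends on \<open>z = x - y\<close> only: it is \<open>1 / m\<close> times
  the character sum of \<open>rho z\<close> over the generating set \<open>S\<close>. Hence the frame angles are the absolute
  values of this normalised sum at the \<open>z \<noteq> 0\<close>, and the multiplicity of an angle counts such \<open>z\<close>.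

  Multiplied by its conjugate, the sum over \<open>S\<close> turns into the sum of \<open>rho z (a - b)\<close> over all pairs.
  Each \<open>d \<in> G\<close> occurs as a difference \<open>m\<close>, \<open>lam\<close> or \<open>mu\<close> times, according as \<open>d = 0\<close>,
  \<open>d \<in> H - {0}\<close> or \<open>d \<notin> H\<close>, and the sum of the nontrivial character \<open>rho z\<close> over \<open>G\<close> is \<open>0\<close>; so what
  remains is \<open>m - lam + (lam - mu) * (\<Sum>h\<in>H. rho z h)\<close> (\<open>norm_sq_sum_divisible_difference_set\<close>).
  The last sum is \<open>l\<close> if \<open>z\<close> annihilates \<open>H\<close> and \<open>0\<close> otherwise, so there are two candidates for an
  angle, which coincide if \<open>lam = mu\<close>. Summing \<open>rho z h\<close> over \<open>z \<in> G\<close>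
  and \<open>h \<in> H\<close> in both orders shows that \<open>n / l\<close> elements \<open>z\<close> annihilate \<open>H\<close>
  (\<open>card_annihilator\<close>), and \<open>0\<close> is one of them; this gives the multiplicities. Tightness is
  orthogonality of the characters attached to the distinct elements of \<open>S\<close>.
\<close>

section \<open>Nondegenerate bicharacters of a finite abelian group\<close>

lemma (in group) quotient_eq_one_iff:
  assumes "x \<in> carrier G" "y \<in> carrier G"
  shows "x \<otimes> inv y = \<one> \<longleftrightarrow> x = y"
  using assms inv_solve_right'[of \<one> x y] by simp

text \<open>
  Such a pairing identifies \<open>G\<close> with its group of characters: \<open>x\<close> corresponds to \<open>r x\<close>. Symmetry makes
  the roles of points and characters interchangeable, which the double counting below exploits.
\<close>

locale character_pairing = comm_group G for G (structure) +
  fixes r :: "'a \<Rightarrow> 'a \<Rightarrow> complex"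
  assumes finite_carrier: "finite (carrier G)"
    and pairing_sym: "x \<in> carrier G \<Longrightarrow> y \<in> carrier G \<Longrightarrow> r x y = r y x"
    and pairing_norm: "x \<in> carrier G \<Longrightarrow> y \<in> carrier G \<Longrightarrow> cmod (r x y) = 1"
    and pairing_mult: "x \<in> carrier G \<Longrightarrow> y \<in> carrier G \<Longrightarrow> z \<in> carrier G \<Longrightarrow> r x (y \<otimes> z) = r x y * r x z"
    and pairing_nondegenerate: "x \<in> carrier G \<Longrightarrow> (\<And>y. y \<in> carrier G \<Longrightarrow> r x y = 1) \<Longrightarrow> x = \<one>"
begin

definition annihilator :: "'a set \<Rightarrow> 'a set" where
  "annihilator K = {x \<in> carrier G. \<forall>h\<in>K. r x h = 1}"

lemma pairing_one:
  assumes "x \<in> carrier G"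
  shows "r x \<one> = 1" and "r \<one> x = 1"
proof -
  have "r x \<one> = r x \<one> * r x \<one>" using pairing_mult[OF assms one_closed one_closed] by simp
  moreover have "r x \<one> \<noteq> 0" using pairing_norm[OF assms one_closed] by auto
  ultimately show 1: "r x \<one> = 1" by simp
  then show "r \<one> x = 1" using pairing_sym[OF assms one_closed] by simp
qed

lemma pairing_inv:
  assumes "x \<in> carrier G" "y \<in> carrier G"
  shows "r x (inv y) = cnj (r x y)"
proof -
  have "r x y * r x (inv y) = 1"
    using pairing_mult[of x y "inv y"] assms pairing_one by simp
  moreover have "r x y * cnj (r x y) = 1"
    using pairing_norm[OF assms] by (simp add: complex_norm_square[symmetric])
  moreover have "r x y \<noteq> 0" using pairing_norm[OF assms] by auto
  ultimately show ?thesis by (metis mult_cancel_left)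
qed

text \<open>
  Translating the sum by an element \<open>h\<close> of \<open>K\<close> multiplies it by \<open>r x h\<close>; if this is not \<open>1\<close> for some
  \<open>h\<close>, then the sum vanishes.
\<close>

lemma sum_subgroup:
  assumes K: "subgroup K G" and x: "x \<in> carrier G"
  shows "(\<Sum>h\<in>K. r x h) = (if x \<in> annihilator K then of_nat (card K) else 0)"
proof (cases "x \<in> annihilator K")
  case True
  then show ?thesis by (simp add: annihilator_def)
next
  case False
  then obtain h where h: "h \<in> K" "r x h \<noteq> 1" using x by (auto simp: annihilator_def)
  have KG: "K \<subseteq> carrier G" using K by (rule subgroup.subset)
  have "(\<Sum>y\<in>K. r x y) = (\<Sum>y\<in>K. r x (h \<otimes> y))"
  proof (rule sum.reindex_bij_witness[where i = "\<lambda>y. h \<otimes> y" and j = "\<lambda>y. inv h \<otimes> y"])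
    fix y assume y: "y \<in> K"
    have hy: "h \<in> carrier G" "y \<in> carrier G" using h y KG by auto
    then show *: "h \<otimes> (inv h \<otimes> y) = y" and "inv h \<otimes> (h \<otimes> y) = y"
      by (simp_all add: m_assoc[symmetric])
    show "inv h \<otimes> y \<in> K" "h \<otimes> y \<in> K"
      using K h y by (simp_all add: subgroup.m_closed subgroup.m_inv_closed)
    show "r x (h \<otimes> (inv h \<otimes> y)) = r x y" using * by simp
  qed
  also have "\<dots> = (\<Sum>y\<in>K. r x h * r x y)"
    using h KG x by (intro sum.cong refl pairing_mult) auto
  also have "\<dots> = r x h * (\<Sum>y\<in>K. r x y)" by (rule sum_distrib_left[symmetric])
  finally show ?thesis using h False by simp
qed

lemma sum_carrier:
  assumes "x \<in> carrier G"
  shows "(\<Sum>y\<in>carrier G. r x y) = (if x = \<one> then of_nat (order G) else 0)"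
proof -
  have "x \<in> annihilator (carrier G) \<longleftrightarrow> x = \<one>"
    using assms pairing_nondegenerate[of x] by (auto simp: annihilator_def pairing_one)
  then show ?thesis using sum_subgroup[OF subgroup_self assms] by (simp add: order_def)
qed

text \<open>
  The sum of \<open>r x h\<close> over all \<open>x \<in> G\<close> and \<open>h \<in> K\<close> counts each annihilating \<open>x\<close> with weight \<open>card K\<close>
  when \<open>h\<close> is summed first, and only \<open>h = \<one>\<close>, with weight \<open>order G\<close>, when \<open>x\<close> is summed first.
\<close>

lemma card_annihilator:
  assumes K: "subgroup K G"
  shows "card (annihilator K) * card K = order G"
proof -
  have KG: "K \<subseteq> carrier G" using K by (rule subgroup.subset)
  have finK: "finite K" using KG finite_carrier by (rule finite_subset)
  have "complex_of_nat (card (annihilator K) * card K)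
      = (\<Sum>x\<in>carrier G. if x \<in> annihilator K then of_nat (card K) else 0)"
    using finite_carrier
    by (simp add: sum.If_cases annihilator_def Int_def cong: conj_cong)
  also have "\<dots> = (\<Sum>x\<in>carrier G. \<Sum>h\<in>K. r x h)"
    using sum_subgroup[OF K] by (intro sum.cong) simp_all
  also have "\<dots> = (\<Sum>h\<in>K. \<Sum>x\<in>carrier G. r x h)" by (rule sum.swap)
  also have "\<dots> = (\<Sum>h\<in>K. \<Sum>x\<in>carrier G. r h x)"
    using KG by (intro sum.cong refl pairing_sym) auto
  also have "\<dots> = (\<Sum>h\<in>K. if h = \<one> then of_nat (order G) else 0)"
    using KG sum_carrier by (intro sum.cong) auto
  also have "\<dots> = of_nat (order G)"
    using finK subgroup.one_closed[OF K] by simp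
  finally show ?thesis by (simp only: of_nat_eq_iff)
qed

section \<open>Character sums over a divisible difference set\<close>

lemma norm_sq_sum:
  assumes S: "S \<subseteq> carrier G" and x: "x \<in> carrier G"
  shows "complex_of_real ((cmod (\<Sum>s\<in>S. r x s))\<^sup>2)
    = (\<Sum>d\<in>carrier G. of_nat (card {(a, b). a \<in> S \<and> b \<in> S \<and> a \<otimes> inv b = d}) * r x d)"
proof -
  have finS: "finite S" using S finite_carrier by (rule finite_subset)
  have "complex_of_real ((cmod (\<Sum>s\<in>S. r x s))\<^sup>2) = (\<Sum>a\<in>S. r x a) * cnj (\<Sum>b\<in>S. r x b)"
    by (rule complex_norm_square)
  also have "\<dots> = (\<Sum>(a, b)\<in>S \<times> S. r x a * cnj (r x b))"
    by (simp add: sum_product sum.cartesian_product)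
  also have "\<dots> = (\<Sum>p\<in>S \<times> S. r x (fst p \<otimes> inv (snd p)))"
    using S x by (intro sum.cong) (auto simp: pairing_mult pairing_inv subset_iff)
  also have "\<dots> = (\<Sum>d\<in>carrier G. \<Sum>p\<in>{p \<in> S \<times> S. fst p \<otimes> inv (snd p) = d}. r x (fst p \<otimes> inv (snd p)))"
    using finS finite_carrier S by (intro sum.group[symmetric]) (auto simp: subset_iff)
  also have "\<dots> = (\<Sum>d\<in>carrier G. of_nat (card {(a, b). a \<in> S \<and> b \<in> S \<and> a \<otimes> inv b = d}) * r x d)"
  proof (rule sum.cong[OF refl])
    fix d
    have "{p \<in> S \<times> S. fst p \<otimes> inv (snd p) = d} = {(a, b). a \<in> S \<and> b \<in> S \<and> a \<otimes> inv b = d}"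
      by auto
    moreover have "(\<Sum>p\<in>{p \<in> S \<times> S. fst p \<otimes> inv (snd p) = d}. r x (fst p \<otimes> inv (snd p)))
        = (\<Sum>p\<in>{p \<in> S \<times> S. fst p \<otimes> inv (snd p) = d}. r x d)"
      by (rule sum.cong) auto
    ultimately show "(\<Sum>p\<in>{p \<in> S \<times> S. fst p \<otimes> inv (snd p) = d}. r x (fst p \<otimes> inv (snd p)))
        = of_nat (card {(a, b). a \<in> S \<and> b \<in> S \<and> a \<otimes> inv b = d}) * r x d"
      by simp
  qed
  finally show ?thesis .
qed

lemma card_trivial_differences:
  assumes "S \<subseteq> carrier G"
  shows "card {(a, b). a \<in> S \<and> b \<in> S \<and> a \<otimes> inv b = \<one>} = card S"
proof -
  have "a \<otimes> inv b = \<one> \<longleftrightarrow> a = b" if "a \<in> S" "b \<in> S" for a b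
    using that assms by (intro quotient_eq_one_iff) auto
  then have "{(a, b). a \<in> S \<and> b \<in> S \<and> a \<otimes> inv b = \<one>} = (\<lambda>a. (a, a)) ` S" by auto
  then show ?thesis by (simp add: card_image inj_on_def)
qed

text \<open>
  The difference counts are the constants \<open>m\<close>, \<open>lam\<close>, \<open>mu\<close> on \<open>{\<one>}\<close>, \<open>H - {\<one>}\<close> and \<open>G - H\<close>, so the
  sum over differences is a combination of the character sums over \<open>{\<one>}\<close>, \<open>H\<close> and \<open>G\<close>, and the
  last one of these is \<open>0\<close>.
\<close>

lemma norm_sq_sum_divisible_difference_set:
  assumes dds: "divisible_difference_set G H n m l lam mu S"
    and x: "x \<in> carrier G" "x \<noteq> \<one>"
  shows "(cmod (\<Sum>s\<in>S. r x s))\<^sup>2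
    = real m - real lam + (if x \<in> annihilator H then real l * (real lam - real mu) else 0)"
proof -
  have H: "subgroup H G" and l: "card H = l" and S: "S \<subseteq> carrier G" and m: "card S = m"
    and lam: "\<And>h. h \<in> H - {\<one>} \<Longrightarrow> card {(a, b). a \<in> S \<and> b \<in> S \<and> a \<otimes> inv b = h} = lam"
    and mu: "\<And>h. h \<in> carrier G - H \<Longrightarrow> card {(a, b). a \<in> S \<and> b \<in> S \<and> a \<otimes> inv b = h} = mu"
    using dds unfolding divisible_difference_set_def by auto
  have HG: "H \<subseteq> carrier G" and oneH: "\<one> \<in> H"
    using H by (auto dest: subgroup.subset subgroup.one_closed)
  have finH: "finite H" using HG finite_carrier by (rule finite_subset)
  let ?c = "\<lambda>d. of_nat (card {(a, b). a \<in> S \<and> b \<in> S \<and> a \<otimes> inv b = d}) * r x d"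
  have "complex_of_real ((cmod (\<Sum>s\<in>S. r x s))\<^sup>2) = (\<Sum>d\<in>carrier G. ?c d)"
    by (rule norm_sq_sum[OF S x(1)])
  also have "\<dots> = (\<Sum>d\<in>carrier G - H. ?c d) + (?c \<one> + (\<Sum>d\<in>H - {\<one>}. ?c d))"
    using finite_carrier HG finH oneH
    by (simp only: sum.subset_diff[of H "carrier G"] sum.remove[of H \<one>])
  also have "?c \<one> = of_nat m"
    using card_trivial_differences[OF S] m x by (simp add: pairing_one)
  also have "(\<Sum>d\<in>H - {\<one>}. ?c d) = of_nat lam * (\<Sum>d\<in>H - {\<one>}. r x d)"
    by (simp add: lam sum_distrib_left)
  also have "(\<Sum>d\<in>H - {\<one>}. r x d) = (\<Sum>d\<in>H. r x d) - 1"
    using finH oneH x by (simp add: sum_diff1 pairing_one)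
  also have "(\<Sum>d\<in>carrier G - H. ?c d) = of_nat mu * (\<Sum>d\<in>carrier G - H. r x d)"
    by (simp add: mu sum_distrib_left)
  also have "(\<Sum>d\<in>carrier G - H. r x d) = - (\<Sum>d\<in>H. r x d)"
    using finite_carrier HG x by (simp add: sum_diff sum_carrier)
  also have "(\<Sum>d\<in>H. r x d) = (if x \<in> annihilator H then of_nat l else 0)"
    using sum_subgroup[OF H x(1)] l by simp
  finally have "complex_of_real ((cmod (\<Sum>s\<in>S. r x s))\<^sup>2)
      = complex_of_real (real m - real lam + (if x \<in> annihilator H then real l * (real lam - real mu) else 0))"
    by (cases "x \<in> annihilator H") (simp_all add: algebra_simps)
  then show ?thesis by (simp only: of_real_eq_iff)
qed

end

section \<open>The characters of a direct sum of cyclic groups\<close>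

lemma carrier_cyclic_sum:
  assumes "\<And>i. i < k \<Longrightarrow> 0 < N i"
  shows "carrier (cyclic_sum k N) = (\<Pi>\<^sub>E i\<in>{..<k}. {0..<int (N i)})"
  using assms unfolding cyclic_sum_def carrier_product_group carrier_integer_mod_group
  by (intro PiE_cong) simp

lemma rho_eq_cis:
  "rho k N x y = cis (2 * pi * (\<Sum>i<k. real_of_int (x i * y i) / real (N i)))"
  unfolding rho_def cis_conv_exp by (simp add: mult_ac)

text \<open>
  Reducing a coordinate of \<open>y + z\<close> modulo \<open>N i\<close> changes the phase by an integer multiple of \<open>2 * pi\<close>.
\<close>

lemma rho_mult:
  assumes N: "\<And>i. i < k \<Longrightarrow> 0 < N i"
  shows "rho k N x (y \<otimes>\<^bsub>cyclic_sum k N\<^esub> z) = rho k N x y * rho k N x z"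
proof -
  let ?w = "y \<otimes>\<^bsub>cyclic_sum k N\<^esub> z"
  let ?q = "\<lambda>i. x i * ((y i + z i) div int (N i))"
  have w: "?w i = y i + z i - int (N i) * ((y i + z i) div int (N i))" if "i < k" for i
    using that by (simp add: cyclic_sum_def mult_integer_mod_group minus_mult_div_eq_mod)
  have "(\<Sum>i<k. real_of_int (x i * y i) / real (N i)) + (\<Sum>i<k. real_of_int (x i * z i) / real (N i))
      = (\<Sum>i<k. real_of_int (x i * ?w i) / real (N i) + real_of_int (?q i))"
    unfolding sum.distrib[symmetric]
  proof (rule sum.cong[OF refl])
    fix i assume "i \<in> {..<k}"
    then have i: "i < k" by simp
    then have "real (N i) \<noteq> 0" using N by simp
    then show "real_of_int (x i * y i) / real (N i) + real_of_int (x i * z i) / real (N i)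
        = real_of_int (x i * ?w i) / real (N i) + real_of_int (?q i)"
      unfolding w[OF i] by (simp add: field_simps)
  qed
  also have "\<dots> = (\<Sum>i<k. real_of_int (x i * ?w i) / real (N i)) + real_of_int (\<Sum>i<k. ?q i)"
    by (simp add: sum.distrib)
  finally have "rho k N x y * rho k N x z
      = rho k N x ?w * cis (2 * pi * real_of_int (\<Sum>i<k. ?q i))"
    unfolding rho_eq_cis cis_mult distrib_left[symmetric] by simp
  moreover have "cis (2 * pi * real_of_int (\<Sum>i<k. ?q i)) = 1"
    by (rule cis_multiple_2pi) (rule Ints_of_int)
  ultimately show ?thesis by (simp only: mult_1_right)
qed

lemma rho_sym: "rho k N x y = rho k N y x"
  unfolding rho_eq_cis by (simp add: mult.commute)

lemma group_cyclic_sum: "comm_group (cyclic_sum k N)"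
proof (rule group.group_comm_groupI)
  show "group (cyclic_sum k N)" unfolding cyclic_sum_def by simp
qed (simp add: cyclic_sum_def add.commute)

text \<open>Evaluating the character of \<open>x\<close> at the \<open>i\<close>-th unit vector recovers \<open>x i\<close> modulo \<open>N i\<close>.\<close>

lemma rho_nondegenerate:
  assumes N: "\<And>i. i < k \<Longrightarrow> 0 < N i"
    and x: "x \<in> carrier (cyclic_sum k N)"
    and triv: "\<And>y. y \<in> carrier (cyclic_sum k N) \<Longrightarrow> rho k N x y = 1"
  shows "x = \<one>\<^bsub>cyclic_sum k N\<^esub>"
proof -
  have xi: "x \<in> (\<Pi>\<^sub>E i\<in>{..<k}. {0..<int (N i)})" using x carrier_cyclic_sum[OF N] by simp
  have "x i = 0" if i: "i < k" for i
  proof (cases "N i = 1")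
    case True
    then show ?thesis using PiE_mem[OF xi, of i] i by simp
  next
    case False
    then have Ni: "1 < N i" using N[OF i] by simp
    define e where "e = (\<lambda>j\<in>{..<k}. if j = i then 1 else 0 :: int)"
    have e: "e \<in> carrier (cyclic_sum k N)"
      using Ni N by (subst carrier_cyclic_sum) (auto simp: e_def)
    have "(\<Sum>j<k. real_of_int (x j * e j) / real (N j))
        = (\<Sum>j<k. if j = i then real_of_int (x i) / real (N i) else 0)"
      unfolding e_def by (intro sum.cong) auto
    also have "\<dots> = real_of_int (x i) / real (N i)" using i by simp
    finally have "cis (2 * pi * (real_of_int (x i) / real (N i))) = 1"
      using triv[OF e] by (simp add: rho_eq_cis)
    then have "cos (2 * pi * (real_of_int (x i) / real (N i))) = 1"
      by (metis Re_complex_of_real cis.sel(1) of_real_1)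
    then obtain q :: int where "2 * pi * (real_of_int (x i) / real (N i)) = real_of_int q * 2 * pi"
      by (auto simp: cos_one_2pi_int)
    then have "real_of_int (x i) = real_of_int (q * int (N i))"
      using Ni by (simp add: field_simps)
    then have "x i = q * int (N i)" by (simp only: of_int_eq_iff)
    moreover have "0 \<le> x i" "x i < int (N i)" using PiE_mem[OF xi, of i] i by simp_all
    ultimately show ?thesis
      by (metis mod_mult_self2_is_0 mod_pos_pos_trivial)
  qed
  then show ?thesis
    using xi by (auto simp: cyclic_sum_def fun_eq_iff PiE_def extensional_def)
qed

lemma character_pairing_rho:
  assumes N: "\<And>i. i < k \<Longrightarrow> 0 < N i"
  shows "character_pairing (cyclic_sum k N) (rho k N)"
proof -
  interpret comm_group "cyclic_sum k N" by (rule group_cyclic_sum)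
  show ?thesis
  proof
    show "finite (carrier (cyclic_sum k N))"
      using N by (subst carrier_cyclic_sum) (auto intro: finite_PiE)
    show "cmod (rho k N x y) = 1" for x y by (simp add: rho_eq_cis)
    show "rho k N x y = rho k N y x" for x y by (rule rho_sym)
    show "rho k N x (y \<otimes>\<^bsub>cyclic_sum k N\<^esub> z) = rho k N x y * rho k N x z" for x y z
      using N by (rule rho_mult)
    show "x = \<one>\<^bsub>cyclic_sum k N\<^esub>"
      if "x \<in> carrier (cyclic_sum k N)" "\<And>y. y \<in> carrier (cyclic_sum k N) \<Longrightarrow> rho k N x y = 1" for x
      using N that by (rule rho_nondegenerate)
  qed
qed

section \<open>Harmonic frames\<close>

lemma unit_norm_harmonic_frame: "unit_norm I (harmonic_frame k N g)"
  unfolding unit_norm_def harmonic_frame_def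
  by (simp add: norm_vec_def L2_set_def norm_divide rho_eq_cis power_divide)

lemma cmod_inner_harmonic_frame:
  fixes g :: "'m::finite \<Rightarrow> nat \<Rightarrow> int"
  assumes N: "\<And>i. i < k \<Longrightarrow> 0 < N i" and g: "inj g" "range g \<subseteq> carrier (cyclic_sum k N)"
    and x: "x \<in> carrier (cyclic_sum k N)" and y: "y \<in> carrier (cyclic_sum k N)"
  shows "cmod (cinner_vec (harmonic_frame k N g x) (harmonic_frame k N g y))
    = 1 / real CARD('m) * cmod (\<Sum>s\<in>range g. rho k N (x \<otimes>\<^bsub>cyclic_sum k N\<^esub> inv\<^bsub>cyclic_sum k N\<^esub> y) s)"
proof -
  interpret character_pairing "cyclic_sum k N" "rho k N" by (rule character_pairing_rho[OF N])
  let ?z = "x \<otimes>\<^bsub>cyclic_sum k N\<^esub> inv\<^bsub>cyclic_sum k N\<^esub> y"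
  let ?c = "complex_of_real (1 / sqrt (real CARD('m)))"
  have c: "?c * ?c = of_real (1 / real CARD('m))"
    unfolding of_real_mult[symmetric] by simp
  have gj: "g j \<in> carrier (cyclic_sum k N)" for j using g by auto
  have z: "?z \<in> carrier (cyclic_sum k N)" using x y by simp
  have "cinner_vec (harmonic_frame k N g x) (harmonic_frame k N g y)
      = (\<Sum>j\<in>UNIV. (?c * ?c) * (rho k N (g j) x * cnj (rho k N (g j) y)))"
    unfolding cinner_vec_def harmonic_frame_def by (simp add: mult_ac)
  also have "\<dots> = (\<Sum>j\<in>UNIV. of_real (1 / real CARD('m)) * rho k N ?z (g j))"
    unfolding c using x y gj
    by (intro sum.cong refl) (simp add: pairing_inv[symmetric] rho_mult[OF N] rho_sym[of k N ?z])
  also have "\<dots> = of_real (1 / real CARD('m)) * (\<Sum>s\<in>range g. rho k N ?z s)"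
    using g by (simp add: sum.reindex sum_distrib_left)
  finally show ?thesis by (simp only: norm_mult norm_of_real) simp
qed

text \<open>
  The entries of the frame operator are, up to normalisation, the inner products of the characters
  \<open>rho (g i)\<close> and \<open>rho (g j)\<close> on \<open>G\<close>, hence character sums of \<open>g i - g j\<close> over all of \<open>G\<close>.
\<close>

lemma tight_frame_harmonic_frame:
  fixes g :: "'m::finite \<Rightarrow> nat \<Rightarrow> int"
  assumes N: "\<And>i. i < k \<Longrightarrow> 0 < N i" and g: "inj g" "range g \<subseteq> carrier (cyclic_sum k N)"
  shows "tight_frame (carrier (cyclic_sum k N)) (harmonic_frame k N g)"
proof -
  interpret character_pairing "cyclic_sum k N" "rho k N" by (rule character_pairing_rho[OF N])
  let ?G = "cyclic_sum k N"
  let ?c = "complex_of_real (1 / sqrt (real CARD('m)))"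
  have c: "?c * ?c = of_real (1 / real CARD('m))"
    unfolding of_real_mult[symmetric] by simp
  have gj: "g j \<in> carrier ?G" for j using g by auto
  define a where "a = real (order ?G) / real CARD('m)"
  have "order ?G > 0" using order_gt_0_iff_finite finite_carrier by simp
  then have "a > 0" unfolding a_def by simp
  have "(\<Sum>x\<in>carrier ?G. outer_vec (harmonic_frame k N g x)) $ i $ j = (a *\<^sub>R mat 1) $ i $ j" for i j
  proof -
    let ?d = "g i \<otimes>\<^bsub>?G\<^esub> inv\<^bsub>?G\<^esub> g j"
    have d: "?d \<in> carrier ?G" using gj by simp
    have "?d = \<one>\<^bsub>?G\<^esub> \<longleftrightarrow> g i = g j"
      using gj by (intro quotient_eq_one_iff)
    then have d1: "?d = \<one>\<^bsub>?G\<^esub> \<longleftrightarrow> i = j" using g by (simp add: inj_eq)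
    have "(\<Sum>x\<in>carrier ?G. outer_vec (harmonic_frame k N g x)) $ i $ j
        = (\<Sum>x\<in>carrier ?G. (?c * ?c) * (rho k N (g i) x * cnj (rho k N (g j) x)))"
      unfolding outer_vec_def harmonic_frame_def by (simp add: sum_component mult_ac)
    also have "\<dots> = (\<Sum>x\<in>carrier ?G. of_real (1 / real CARD('m)) * rho k N ?d x)"
    proof (rule sum.cong[OF refl])
      fix x assume x: "x \<in> carrier ?G"
      have "rho k N ?d x = rho k N x (g i) * rho k N x (inv\<^bsub>?G\<^esub> g j)"
        by (simp add: rho_sym[of k N ?d] rho_mult[OF N])
      also have "\<dots> = rho k N (g i) x * cnj (rho k N (g j) x)"
        unfolding pairing_inv[OF x gj] by (simp only: rho_sym[of k N x])
      finally show "(?c * ?c) * (rho k N (g i) x * cnj (rho k N (g j) x))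
          = of_real (1 / real CARD('m)) * rho k N ?d x"
        unfolding c by simp
    qed
    also have "\<dots> = of_real (1 / real CARD('m)) * (if i = j then of_nat (order ?G) else 0)"
      by (simp only: sum_distrib_left[symmetric] sum_carrier[OF d] d1)
    also have "\<dots> = (a *\<^sub>R mat 1) $ i $ j"
      by (cases "i = j") (simp_all add: a_def mat_def of_real_def[symmetric])
    finally show ?thesis .
  qed
  then have "(\<Sum>x\<in>carrier ?G. outer_vec (harmonic_frame k N g x)) = a *\<^sub>R mat 1"
    unfolding vec_eq_iff by blast
  then show ?thesis using \<open>a > 0\<close> unfolding tight_frame_def by blast
qed

section \<open>Frames whose angles depend on the difference of the indices\<close>

context group
begin

lemma frame_angles_eq_image:
  fixes f :: "'a \<Rightarrow> complex ^ 'm::finite"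
  assumes A: "\<And>x y. x \<in> carrier G \<Longrightarrow> y \<in> carrier G \<Longrightarrow> cmod (cinner_vec (f x) (f y)) = A (x \<otimes> inv y)"
  shows "frame_angles (carrier G) f = A ` (carrier G - {\<one>})"
proof (intro equalityI subsetI)
  fix t assume "t \<in> frame_angles (carrier G) f"
  then obtain x y where "x \<in> carrier G" "y \<in> carrier G" "x \<noteq> y" "t = cmod (cinner_vec (f x) (f y))"
    unfolding frame_angles_def by blast
  then show "t \<in> A ` (carrier G - {\<one>})"
    using A by (intro image_eqI[of _ _ "x \<otimes> inv y"]) (auto simp: quotient_eq_one_iff)
next
  fix t assume "t \<in> A ` (carrier G - {\<one>})"
  then obtain z where z: "z \<in> carrier G" "z \<noteq> \<one>" "t = A z" by blast
  then have "t = cmod (cinner_vec (f z) (f \<one>))" using A[of z \<one>] by simp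
  then show "t \<in> frame_angles (carrier G) f"
    using z unfolding frame_angles_def by blast
qed

text \<open>
  For fixed \<open>x\<close>, the bijection \<open>y \<mapsto> x \<otimes> inv y\<close> turns indices into differences, so the count is the
  same for every \<open>x\<close>.
\<close>

lemma angle_multiplicity_eq_card:
  fixes f :: "'a \<Rightarrow> complex ^ 'm::finite"
  assumes A: "\<And>x y. x \<in> carrier G \<Longrightarrow> y \<in> carrier G \<Longrightarrow> cmod (cinner_vec (f x) (f y)) = A (x \<otimes> inv y)"
  shows "angle_multiplicity (carrier G) f t (card {z \<in> carrier G - {\<one>}. A z = t})"
  unfolding angle_multiplicity_def
proof
  fix x assume x: "x \<in> carrier G"
  have cancel: "inv (x \<otimes> inv y) \<otimes> x = y" "x \<otimes> inv (inv y \<otimes> x) = y" if "y \<in> carrier G" for y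
    using that x by (simp_all add: inv_mult_group m_assoc) (simp_all add: m_assoc[symmetric])
  have "bij_betw (\<lambda>y. x \<otimes> inv y) {y \<in> carrier G. y \<noteq> x \<and> cmod (cinner_vec (f x) (f y)) = t}
      {z \<in> carrier G - {\<one>}. A z = t}"
    by (rule bij_betw_byWitness[where f' = "\<lambda>z. inv z \<otimes> x"])
      (use x A cancel in \<open>auto simp: quotient_eq_one_iff inv_solve_left'\<close>)
  then show "card {y \<in> carrier G. y \<noteq> x \<and> cmod (cinner_vec (f x) (f y)) = t}
      = card {z \<in> carrier G - {\<one>}. A z = t}"
    by (rule bij_betw_same_card)
qed

end

section \<open>Harmonic frames generated by divisible difference sets\<close>

theorem theorem4p16:
  fixes k n l lam mu :: nat
    and N :: "nat \<Rightarrow> nat"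
    and H :: "(nat \<Rightarrow> int) set"
    and g :: "'m::finite \<Rightarrow> nat \<Rightarrow> int"
  assumes N_pos: "\<And>i. i < k \<Longrightarrow> 0 < N i"
    and g_inj: "inj g"
    and dds: "divisible_difference_set (cyclic_sum k N) H n CARD('m) l lam mu (range g)"
    and nontrivial_group: "2 \<le> n"
    and nondegenerate: "lam \<noteq> mu \<Longrightarrow> 1 < l \<and> l < n"
  shows
    "(lam = mu \<and>
      equiangular (carrier (cyclic_sum k N)) (harmonic_frame k N g) \<and>
      tight_frame (carrier (cyclic_sum k N)) (harmonic_frame k N g))
   \<or> (lam \<noteq> mu \<and>
      biangular (carrier (cyclic_sum k N)) (harmonic_frame k N g) \<and>
      tight_frame (carrier (cyclic_sum k N)) (harmonic_frame k N g) \<and>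
      (let m = real CARD('m);
           \<alpha>1 = 1 / m * sqrt (m - real lam + real l * (real lam - real mu));
           \<alpha>2 = 1 / m * sqrt (m - real lam)
       in frame_angles (carrier (cyclic_sum k N)) (harmonic_frame k N g) = {\<alpha>1, \<alpha>2} \<and>
          angle_multiplicity (carrier (cyclic_sum k N)) (harmonic_frame k N g) \<alpha>1 (n div l - 1) \<and>
          angle_multiplicity (carrier (cyclic_sum k N)) (harmonic_frame k N g) \<alpha>2 (n - n div l)))"
proof -
  let ?G = "cyclic_sum k N"
  let ?f = "harmonic_frame k N g"
  let ?m = "real CARD('m)"
  interpret character_pairing ?G "rho k N" by (rule character_pairing_rho[OF N_pos])
  have H: "subgroup H ?G" and l: "card H = l" and n: "order ?G = n"
    and S: "range g \<subseteq> carrier ?G"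
    using dds unfolding divisible_difference_set_def by auto
  define A where "A = (\<lambda>z. 1 / ?m * cmod (\<Sum>s\<in>range g. rho k N z s))"
  define \<alpha>1 where "\<alpha>1 = 1 / ?m * sqrt (?m - real lam + real l * (real lam - real mu))"
  define \<alpha>2 where "\<alpha>2 = 1 / ?m * sqrt (?m - real lam)"
  have inner: "cmod (cinner_vec (?f x) (?f y)) = A (x \<otimes>\<^bsub>?G\<^esub> inv\<^bsub>?G\<^esub> y)"
    if "x \<in> carrier ?G" "y \<in> carrier ?G" for x y
    unfolding A_def using cmod_inner_harmonic_frame[OF N_pos g_inj S that] .
  have sq: "?m - real lam + (if z \<in> annihilator H then real l * (real lam - real mu) else 0)
      = (?m * A z)\<^sup>2"
    if "z \<in> carrier ?G - {\<one>\<^bsub>?G\<^esub>}" for z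
    using norm_sq_sum_divisible_difference_set[OF dds] that by (simp add: A_def)
  have A: "A z = (if z \<in> annihilator H then \<alpha>1 else \<alpha>2)" if z: "z \<in> carrier ?G - {\<one>\<^bsub>?G\<^esub>}" for z
  proof -
    have "?m * A z \<ge> 0" unfolding A_def by simp
    then have "A z = 1 / ?m * sqrt ((?m * A z)\<^sup>2)" by simp
    then show ?thesis unfolding sq[OF z, symmetric] \<alpha>1_def \<alpha>2_def by simp
  qed
  have angles: "frame_angles (carrier ?G) ?f = A ` (carrier ?G - {\<one>\<^bsub>?G\<^esub>})"
    by (rule frame_angles_eq_image) (rule inner)
  have tight: "tight_frame (carrier ?G) ?f"
    by (rule tight_frame_harmonic_frame[OF N_pos g_inj S])
  have card_G1: "card (carrier ?G - {\<one>\<^bsub>?G\<^esub>}) = n - 1"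
    using n by (simp add: order_def)
  show ?thesis
  proof (cases "lam = mu")
    case True
    then have "\<alpha>1 = \<alpha>2" unfolding \<alpha>1_def \<alpha>2_def by simp
    then have "A ` (carrier ?G - {\<one>\<^bsub>?G\<^esub>}) = (\<lambda>z. \<alpha>2) ` (carrier ?G - {\<one>\<^bsub>?G\<^esub>})"
      using A by (intro image_cong) auto
    moreover have "carrier ?G - {\<one>\<^bsub>?G\<^esub>} \<noteq> {}"
      using card_G1 nontrivial_group by (metis One_nat_def card.empty diff_is_0_eq not_less_eq_eq numeral_2_eq_2)
    ultimately have "card (frame_angles (carrier ?G) ?f) = 1"
      unfolding angles by (simp add: image_constant_conv)
    then show ?thesis using True tight unit_norm_harmonic_frame unfolding equiangular_def by blast
  next
    case False
    then have l1: "1 < l" and ln: "l < n" using nondegenerate by auto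
    let ?Z = "annihilator H"
    have Z: "?Z \<subseteq> carrier ?G" "finite ?Z" and oneZ: "\<one>\<^bsub>?G\<^esub> \<in> ?Z"
      using finite_carrier subgroup.subset[OF H] by (auto simp: annihilator_def intro: pairing_one)
    have mult: "card ?Z * l = n" using card_annihilator[OF H] l n by simp
    then have cardZ: "card ?Z = n div l" using l1 by (metis nonzero_mult_div_cancel_right not_one_less_zero)
    have cZ1: "card (?Z - {\<one>\<^bsub>?G\<^esub>}) = n div l - 1" using oneZ cardZ by simp
    have cZ2: "card (carrier ?G - ?Z) = n - n div l"
      using Z n cardZ by (simp add: card_Diff_subset order_def)
    \<comment> \<open>Both kinds of difference occur because \<open>1 < n div l < n\<close>.\<close>
    have "1 < card ?Z" using mult ln by (cases "card ?Z = 0 \<or> card ?Z = 1") auto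
    then obtain z1 where z1: "z1 \<in> ?Z - {\<one>\<^bsub>?G\<^esub>}"
      using cZ1 cardZ by (metis all_not_in_conv card.empty less_numeral_extra(3) zero_less_diff)
    have "card ?Z < n" using mult l1 ln by (metis \<open>1 < card ?Z\<close> less_trans mult.right_neutral nat_mult_less_cancel_disj zero_less_one)
    then obtain z2 where z2: "z2 \<in> carrier ?G - ?Z"
      using cZ2 cardZ by (metis all_not_in_conv card.empty less_numeral_extra(3) zero_less_diff)
    have z12: "z1 \<in> carrier ?G - {\<one>\<^bsub>?G\<^esub>}" "z2 \<in> carrier ?G - {\<one>\<^bsub>?G\<^esub>}" using z1 z2 Z oneZ by auto
    \<comment> \<open>As \<open>sqrt\<close> is injective on all of \<open>\<real>\<close>, it suffices that the radicands differ.\<close>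
    have ne: "\<alpha>1 \<noteq> \<alpha>2"
      unfolding \<alpha>1_def \<alpha>2_def using False l1 by simp
    have "A ` (carrier ?G - {\<one>\<^bsub>?G\<^esub>}) = {\<alpha>1, \<alpha>2}"
    proof
      show "A ` (carrier ?G - {\<one>\<^bsub>?G\<^esub>}) \<subseteq> {\<alpha>1, \<alpha>2}" using A by auto
      have "A z1 = \<alpha>1" "A z2 = \<alpha>2" using A[OF z12(1)] A[OF z12(2)] z1 z2 by auto
      then show "{\<alpha>1, \<alpha>2} \<subseteq> A ` (carrier ?G - {\<one>\<^bsub>?G\<^esub>})" using z12 by blast
    qed
    then have ang: "frame_angles (carrier ?G) ?f = {\<alpha>1, \<alpha>2}" using angles by simp
    have bi: "biangular (carrier ?G) ?f"
      using ang ne unit_norm_harmonic_frame unfolding biangular_def by auto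
    have A_iff: "A z = \<alpha>1 \<longleftrightarrow> z \<in> ?Z" "A z = \<alpha>2 \<longleftrightarrow> z \<notin> ?Z"
      if "z \<in> carrier ?G - {\<one>\<^bsub>?G\<^esub>}" for z
      using A[OF that] ne by simp_all
    have "{z \<in> carrier ?G - {\<one>\<^bsub>?G\<^esub>}. A z = \<alpha>1} = ?Z - {\<one>\<^bsub>?G\<^esub>}"
      using A_iff Z(1) by blast
    then have m1: "angle_multiplicity (carrier ?G) ?f \<alpha>1 (n div l - 1)"
      using angle_multiplicity_eq_card[of ?f A \<alpha>1, OF inner] cZ1 by simp
    have "{z \<in> carrier ?G - {\<one>\<^bsub>?G\<^esub>}. A z = \<alpha>2} = carrier ?G - ?Z"
      using A_iff oneZ by blast
    then have m2: "angle_multiplicity (carrier ?G) ?f \<alpha>2 (n - n div l)"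
      using angle_multiplicity_eq_card[of ?f A \<alpha>2, OF inner] cZ2 by simp
    show ?thesis
      using False bi tight ang m1 m2 unfolding Let_def \<alpha>1_def \<alpha>2_def by blast
  qed
qed

end
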